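(* For all integers $p>1$, $n\ge 0$, $k>0$, $d>0$, the number $O(p,n,k,d)$ can be computed by the formula $$O(p,n,k,d)=\sum_{j=1}^{d-1}\ \sum_{i=k}^{n} O(p-1,n,i,d-j)\cdot O(p,i-1,k-1,j).$$
   Context: Let $K$ be a field and $K[x_1,\dots,x_p]$ a standard graded polynomial ring with variables ordered $x_1<\dots<x_p$. A term is a power product of the variables. For a monomial ideal $J$, its sous-escalier $\mathcal N(J)$ is the set of terms not in $J$. A monomial ideal $J$ is a lex-segment ideal if for every degree $t$ and every term $\tau\in\mathcal N(J)$ of degree $t$, each term $\sigma$ of degree $t$ that is lower than $\tau$ in the lexicographic term order also belongs to $\mathcal N(J)$. The Hilbert function of $J$ is the sequence $(a_0,a_1,\dots)$, where $a_t$ is the number of terms of degree $t$ in $\mathcal N(J)$; if $J$ is Artinian (i.e. $\mathcal N(J)$ is finite), it is a finite $O$-sequence $(a_0,\dots,a_s)$ with $a_s\ne 0$ (and $a_i=0$ for $i>s$), $s$ is called its socle degree, and $\sum_i a_i$ its multiplicity. There is a bijection between Hilbert functions (O-sequences) and lex-segment ideals: each Hilbert function $H=(a_0,a_1,\dots)$ is the Hilbert function of $K[x_1,\dots,x_{a_1}]/L$ for a unique lex-segment ideal $L\subseteq K[x_1,\dots,x_{a_1}]$. For integers $p>0$, $n\ge 0$, $k\ge 0$, $d>0$, let $M(p,n,k,d)$ be the set of all sous-escaliers of Artinian lex-segment ideals in at most $p$ variables (viewed as sets of terms in $x_1,\dots,x_p$) corresponding to finite $O$-sequences $(a_0,a_1,\dots,a_s)$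 of multiplicity $d$ such that: the socle degree $s$ is at most $n$; $a_i=\binom{p-1+i}{i}$ for all $0\le i\le k$; and $a_i<\binom{p-1+i}{i}$ for all $i>k$. The cardinality of $M(p,n,k,d)$ is denoted $O(p,n,k,d)$. Empty sums are $0$. *)

theory Defs
  imports Complex_Main "HOL-Library.Poly_Mapping" "HOL-Algebra.Ideal"
begin

text \<open>A term is an exponent vector \<open>nat \<Rightarrow>\<^sub>0 nat\<close> supported in \<open>{1..p}\<close>; in this encoding the
  terms in \<open>x\<^sub>1, \<dots>, x\<^sub>q\<close> are literally among the terms in \<open>x\<^sub>1, \<dots>, x\<^sub>p\<close> whenever \<open>q \<le> p\<close>.\<close>

type_synonym pp = "nat \<Rightarrow>\<^sub>0 nat"

definition pterms :: "nat \<Rightarrow> pp set" where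
  "pterms p = {\<tau>. Poly_Mapping.keys \<tau> \<subseteq> {1..p}}"

definition tdeg :: "pp \<Rightarrow> nat" where
  "tdeg \<tau> = (\<Sum>i\<in>Poly_Mapping.keys \<tau>. Poly_Mapping.lookup \<tau> i)"

text \<open>Since \<open>x\<^sub>1 < x\<^sub>2 < \<dots>\<close>, the largest index at which the exponents differ decides. (The order
  instance in \<^theory>\<open>HOL-Library.Poly_Mapping\<close> compares from the smallest index.)\<close>

definition lex_less :: "pp \<Rightarrow> pp \<Rightarrow> bool" where
  "lex_less \<sigma> \<tau> \<longleftrightarrow>
     (\<exists>i. Poly_Mapping.lookup \<sigma> i < Poly_Mapping.lookup \<tau> i \<and>
          (\<forall>j>i. Poly_Mapping.lookup \<sigma> j = Poly_Mapping.lookup \<tau> j))"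

definition poly_ring :: "nat \<Rightarrow> (pp \<Rightarrow>\<^sub>0 'a::field) ring" where
  "poly_ring p =
     \<lparr>carrier = {f. Poly_Mapping.keys f \<subseteq> pterms p}, monoid.mult = (*), one = 1,
      zero = 0, add = (+)\<rparr>"

definition monomial_ideal :: "nat \<Rightarrow> (pp \<Rightarrow>\<^sub>0 'a::field) set \<Rightarrow> bool" where
  "monomial_ideal p J \<longleftrightarrow>
     ideal J (poly_ring p) \<and>
     (\<exists>T\<subseteq>pterms p. J = genideal (poly_ring p) ((\<lambda>\<tau>. Poly_Mapping.single \<tau> 1) ` T))"

definition sous_escalier :: "nat \<Rightarrow> (pp \<Rightarrow>\<^sub>0 'a::field) set \<Rightarrow> pp set" where
  "sous_escalier p J = {\<tau> \<in> pterms p. Poly_Mapping.single \<tau> 1 \<notin> J}"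

definition lex_segment_ideal :: "nat \<Rightarrow> (pp \<Rightarrow>\<^sub>0 'a::field) set \<Rightarrow> bool" where
  "lex_segment_ideal p J \<longleftrightarrow>
     monomial_ideal p J \<and>
     (\<forall>t. \<forall>\<tau>\<in>sous_escalier p J. tdeg \<tau> = t \<longrightarrow>
        (\<forall>\<sigma>\<in>pterms p. tdeg \<sigma> = t \<and> lex_less \<sigma> \<tau> \<longrightarrow> \<sigma> \<in> sous_escalier p J))"

definition artinian :: "nat \<Rightarrow> (pp \<Rightarrow>\<^sub>0 'a::field) set \<Rightarrow> bool" where
  "artinian p J \<longleftrightarrow> finite (sous_escalier p J)"

definition hilbert_function :: "nat \<Rightarrow> (pp \<Rightarrow>\<^sub>0 'a::field) set \<Rightarrow> nat \<Rightarrow> nat" where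
  "hilbert_function p J t = card {\<tau> \<in> sous_escalier p J. tdeg \<tau> = t}"

text \<open>The next two notions are meant for sequences that are nonzero but have only finitely many
  nonzero entries.\<close>

definition socle_degree :: "(nat \<Rightarrow> nat) \<Rightarrow> nat" where
  "socle_degree a = (GREATEST s. a s \<noteq> 0)"

definition multiplicity :: "(nat \<Rightarrow> nat) \<Rightarrow> nat" where
  "multiplicity a = (\<Sum>i\<le>socle_degree a. a i)"

text \<open>The number of variables \<open>q\<close> may be any number up to \<open>p\<close>, while the comparison values
  \<open>p - 1 + i choose i\<close> count the terms of degree \<open>i\<close> in \<open>p\<close> variables. The type argument carries
  the field \<open>K\<close>.\<close>

definition lex_escaliers ::
    "'a::field itself \<Rightarrow> nat \<Rightarrow> nat \<Rightarrow> nat \<Rightarrow> nat \<Rightarrow> pp set set" where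
  "lex_escaliers K p n k d =
     {sous_escalier q J | q (J :: (pp \<Rightarrow>\<^sub>0 'a) set).
        q \<le> p \<and> lex_segment_ideal q J \<and> artinian q J \<and>
        multiplicity (hilbert_function q J) = d \<and>
        socle_degree (hilbert_function q J) \<le> n \<and>
        (\<forall>i\<le>k. hilbert_function q J i = (p - 1 + i) choose i) \<and>
        (\<forall>i>k. hilbert_function q J i < (p - 1 + i) choose i)}"

definition num_lex_escaliers :: "'a::field itself \<Rightarrow> nat \<Rightarrow> nat \<Rightarrow> nat \<Rightarrow> nat \<Rightarrow> nat" where
  "num_lex_escaliers K p n k d = card (lex_escaliers K p n k d)"

end

theory Submission
  imports Defs
begin

text \<open>A sous-escalier \<open>N\<close> is cut along the highest variable \<open>x\<^sub>p\<close> into its terms \<open>A\<close> free of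
  \<open>x\<^sub>p\<close> and the set \<open>B\<close> of all \<open>\<sigma>\<close> with \<open>x\<^sub>p \<sigma> \<in> N\<close>. Terms free of \<open>x\<^sub>p\<close> are the lowest of their
  degree, so if \<open>i\<close> is the last degree in which \<open>A\<close> contains all terms in \<open>p - 1\<close> variables, then \<open>B\<close>
  lives in degrees at most \<open>i - 1\<close>, and it is full exactly up to degree \<open>k - 1\<close>. Conversely every
  such pair glues back to a sous-escalier, and the multiplicities of \<open>A\<close> and \<open>B\<close> add up. Summing
  over \<open>i\<close> and the multiplicity \<open>j\<close> of \<open>B\<close> gives the formula. Fewer than \<open>p\<close> variables need no
  separate treatment: a lex-segment sous-escalier in \<open>q \<le> p\<close> variables is one in \<open>p\<close> variables.\<close>

section \<open>Terms\<close>

definition deg_terms :: "nat \<Rightarrow> nat \<Rightarrow> pp set" where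
  "deg_terms p t = {\<tau> \<in> pterms p. tdeg \<tau> = t}"

definition var :: "nat \<Rightarrow> pp" where
  "var i = Poly_Mapping.single i 1"

lemma lookup_var: "Poly_Mapping.lookup (var i) j = (if i = j then 1 else 0)"
  by (simp add: var_def lookup_single when_def)

lemma pterms_iff: "\<tau> \<in> pterms p \<longleftrightarrow> (\<forall>i. Poly_Mapping.lookup \<tau> i \<noteq> 0 \<longrightarrow> 1 \<le> i \<and> i \<le> p)"
  by (auto simp: pterms_def in_keys_iff subset_iff)

lemma zero_in_pterms: "0 \<in> pterms p"
  by (simp add: pterms_iff)

lemma pterms_mono: "q \<le> p \<Longrightarrow> pterms q \<subseteq> pterms p"
  unfolding pterms_iff subset_iff by (meson order_trans)

lemma add_in_pterms_iff: "\<sigma> + \<tau> \<in> pterms p \<longleftrightarrow> \<sigma> \<in> pterms p \<and> \<tau> \<in> pterms p"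
  by (auto simp: pterms_iff lookup_add)

lemma var_in_pterms_iff: "var i \<in> pterms p \<longleftrightarrow> 1 \<le> i \<and> i \<le> p"
  by (auto simp: pterms_iff lookup_var)

lemma var_Suc_add_notin_pterms: "var (Suc m) + \<sigma> \<notin> pterms m"
  by (simp add: add_in_pterms_iff var_in_pterms_iff)

lemma var_add_in_pterms_iff: "var (Suc m) + \<sigma> \<in> pterms (Suc m) \<longleftrightarrow> \<sigma> \<in> pterms (Suc m)"
  by (simp add: add_in_pterms_iff var_in_pterms_iff)

lemma obtain_var_factor:
  assumes "Poly_Mapping.lookup \<tau> i \<noteq> 0"
  obtains \<sigma> where "\<tau> = var i + \<sigma>"
proof
  show "\<tau> = var i + (\<tau> - var i)"
    using assms by (intro poly_mapping_eqI) (auto simp: lookup_add lookup_minus lookup_var)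
qed

text \<open>Divisibility by the top variable is the dichotomy behind both the count of terms and the
  splitting of sous-escaliers.\<close>

lemma pterms_Suc_cases:
  assumes "\<tau> \<in> pterms (Suc m)"
  obtains "\<tau> \<in> pterms m" | \<sigma> where "\<sigma> \<in> pterms (Suc m)" "\<tau> = var (Suc m) + \<sigma>"
proof (cases "Poly_Mapping.lookup \<tau> (Suc m) = 0")
  case True
  then have "\<tau> \<in> pterms m"
    using assms unfolding pterms_iff by (metis le_Suc_eq)
  then show ?thesis by (rule that(1))
next
  case False
  then obtain \<sigma> where "\<tau> = var (Suc m) + \<sigma>" by (rule obtain_var_factor)
  then show ?thesis using that(2) assms by (simp add: var_add_in_pterms_iff)
qed

section \<open>Total degree\<close>

lemma tdeg_superset:
  assumes "finite A" "Poly_Mapping.keys \<tau> \<subseteq> A"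
  shows "tdeg \<tau> = (\<Sum>i\<in>A. Poly_Mapping.lookup \<tau> i)"
  unfolding tdeg_def using assms by (intro sum.mono_neutral_left) (auto simp: in_keys_iff)

lemma tdeg_add: "tdeg (\<sigma> + \<tau>) = tdeg \<sigma> + tdeg \<tau>"
proof -
  define A where "A = Poly_Mapping.keys \<sigma> \<union> Poly_Mapping.keys \<tau>"
  have A: "finite A" "Poly_Mapping.keys \<sigma> \<subseteq> A" "Poly_Mapping.keys \<tau> \<subseteq> A"
      "Poly_Mapping.keys (\<sigma> + \<tau>) \<subseteq> A"
    using Poly_Mapping.keys_add[of \<sigma> \<tau>] by (auto simp: A_def)
  show ?thesis
    using A by (simp add: tdeg_superset[of A] lookup_add sum.distrib)
qed

lemma tdeg_var: "tdeg (var i) = 1"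
  by (simp add: tdeg_def var_def)

lemma tdeg_eq_0_iff: "tdeg \<tau> = 0 \<longleftrightarrow> \<tau> = 0"
proof
  assume "tdeg \<tau> = 0"
  then show "\<tau> = 0"
    by (intro poly_mapping_eqI) (auto simp: tdeg_def in_keys_iff)
qed (simp add: tdeg_def)

section \<open>Counting the terms of a given degree\<close>

lemma deg_terms_0: "deg_terms p 0 = {0}"
  by (auto simp: deg_terms_def tdeg_eq_0_iff zero_in_pterms)

lemma deg_terms_no_vars: "deg_terms 0 (Suc t) = {}"
proof -
  have "\<tau> = 0" if "\<tau> \<in> pterms 0" for \<tau>
    using that by (intro poly_mapping_eqI) (force simp: pterms_iff)
  then show ?thesis using tdeg_eq_0_iff[of 0] by (force simp: deg_terms_def)
qed

text \<open>Pascal's rule at the level of sets: a term is sorted by whether the top variable divides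
  it.\<close>

lemma deg_terms_Suc:
  "deg_terms (Suc m) (Suc t) = deg_terms m (Suc t) \<union> (+) (var (Suc m)) ` deg_terms (Suc m) t"
  (is "?L = ?A \<union> ?B")
proof
  show "?L \<subseteq> ?A \<union> ?B"
  proof
    fix \<tau> assume \<tau>: "\<tau> \<in> ?L"
    then have "\<tau> \<in> pterms (Suc m)" by (simp add: deg_terms_def)
    then show "\<tau> \<in> ?A \<union> ?B"
      by (cases rule: pterms_Suc_cases) (use \<tau> in \<open>auto simp: deg_terms_def tdeg_add tdeg_var\<close>)
  qed
  show "?A \<union> ?B \<subseteq> ?L"
    using pterms_mono[of m "Suc m"]
    by (auto simp: deg_terms_def tdeg_add tdeg_var var_add_in_pterms_iff)
qed

lemma finite_deg_terms: "finite (deg_terms p t)"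
proof (induction p arbitrary: t)
  case 0
  show ?case by (cases t) (simp_all add: deg_terms_0 deg_terms_no_vars)
next
  case (Suc m)
  show ?case by (induction t) (simp_all add: deg_terms_0 deg_terms_Suc Suc.IH)
qed

lemma card_deg_terms_Suc:
  "card (deg_terms (Suc m) (Suc t)) = card (deg_terms m (Suc t)) + card (deg_terms (Suc m) t)"
proof -
  have "deg_terms m (Suc t) \<inter> (+) (var (Suc m)) ` deg_terms (Suc m) t = {}"
    by (auto simp: deg_terms_def var_Suc_add_notin_pterms)
  then show ?thesis
    by (simp add: deg_terms_Suc card_Un_disjoint finite_deg_terms card_image)
qed

text \<open>Double induction along Pascal's rule. Writing the number of variables as
  \<open>Suc m\<close> avoids truncated subtraction.\<close>

lemma card_deg_terms: "card (deg_terms (Suc m) t) = (m + t) choose t"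
proof (induction m arbitrary: t)
  case 0
  show ?case by (induction t) (simp_all add: deg_terms_0 card_deg_terms_Suc deg_terms_no_vars)
next
  case (Suc m)
  show ?case by (induction t) (simp_all add: deg_terms_0 card_deg_terms_Suc[of "Suc m"] Suc.IH)
qed

lemma deg_terms_nonempty: "0 < p \<Longrightarrow> deg_terms p t \<noteq> {}"
  using card_deg_terms[of "p - 1" t] by force

section \<open>The lexicographic order\<close>

text \<open>The deciding index has a positive exponent in \<open>\<tau>\<close>, so it is at most
  \<open>q\<close>; beyond it the exponents agree. Membership in \<open>pterms p\<close> excludes
  index 0 from \<open>\<sigma>\<close>.\<close>

lemma lex_less_pterms:
  assumes "lex_less \<sigma> \<tau>" "\<tau> \<in> pterms q" "\<sigma> \<in> pterms p"
  shows "\<sigma> \<in> pterms q"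
proof -
  obtain i where i: "Poly_Mapping.lookup \<sigma> i < Poly_Mapping.lookup \<tau> i"
      "\<And>j. j > i \<Longrightarrow> Poly_Mapping.lookup \<sigma> j = Poly_Mapping.lookup \<tau> j"
    using assms(1) unfolding lex_less_def by blast
  have "i \<le> q" using i(1) assms(2) by (auto simp: pterms_iff)
  then show ?thesis
    using assms(2,3) i(2) unfolding pterms_iff by (metis le_trans not_le)
qed

lemma lex_less_add_left_iff: "lex_less (\<rho> + \<sigma>) (\<rho> + \<tau>) \<longleftrightarrow> lex_less \<sigma> \<tau>"
  by (simp add: lex_less_def lookup_add)

text \<open>The exponent of the top variable decides: 0 on the left, positive on the right.\<close>

lemma lex_less_var_Suc_add:
  assumes "\<sigma> \<in> pterms m" "\<tau> \<in> pterms (Suc m)"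
  shows "lex_less \<sigma> (var (Suc m) + \<tau>)"
proof -
  have "Poly_Mapping.lookup \<sigma> j = 0" if "j > m" for j
    using assms(1) that unfolding pterms_iff by (metis not_le)
  moreover have "Poly_Mapping.lookup \<tau> j = 0" if "j > Suc m" for j
    using assms(2) that unfolding pterms_iff by (metis not_le)
  ultimately show ?thesis
    unfolding lex_less_def by (intro exI[of _ "Suc m"]) (simp add: lookup_add lookup_var)
qed

section \<open>Sous-escaliers of monomial ideals\<close>

lemma ring_poly_ring: "ring (poly_ring p :: (pp \<Rightarrow>\<^sub>0 'a::field) ring)"
proof -
  have add: "Poly_Mapping.keys (f + g) \<subseteq> pterms p"
    if "Poly_Mapping.keys f \<subseteq> pterms p" "Poly_Mapping.keys g \<subseteq> pterms p"
    for f g :: "pp \<Rightarrow>\<^sub>0 'a"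
    using that Poly_Mapping.keys_add[of f g] by blast
  have mult: "Poly_Mapping.keys (f * g) \<subseteq> pterms p"
    if "Poly_Mapping.keys f \<subseteq> pterms p" "Poly_Mapping.keys g \<subseteq> pterms p"
    for f g :: "pp \<Rightarrow>\<^sub>0 'a"
    using that keys_mult[of f g] by (fastforce simp: add_in_pterms_iff)
  have "\<exists>g. Poly_Mapping.keys g \<subseteq> pterms p \<and> g + f = 0"
    if "Poly_Mapping.keys f \<subseteq> pterms p" for f :: "pp \<Rightarrow>\<^sub>0 'a"
    using that by (intro exI[of _ "- f"]) simp
  then have "abelian_group (poly_ring p :: (pp \<Rightarrow>\<^sub>0 'a) ring)"
    by (intro abelian_groupI) (auto simp: poly_ring_def ac_simps dest: add[THEN subsetD])
  moreover have "monoid (poly_ring p :: (pp \<Rightarrow>\<^sub>0 'a) ring)"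
    by (intro monoidI)
       (auto simp: poly_ring_def ac_simps zero_in_pterms dest: mult[THEN subsetD])
  ultimately show ?thesis
    by (intro ringI) (auto simp: poly_ring_def algebra_simps)
qed

text \<open>The combinatorial form of being the complement of a monomial ideal. Quantifying over all
  exponent vectors is harmless: a product in \<open>pterms p\<close> has both factors there.\<close>

definition divisor_closed :: "pp set \<Rightarrow> bool" where
  "divisor_closed N \<longleftrightarrow> (\<forall>\<sigma> \<tau>. \<sigma> + \<tau> \<in> N \<longrightarrow> \<sigma> \<in> N)"

lemma divisor_closedD: "divisor_closed N \<Longrightarrow> \<sigma> + \<tau> \<in> N \<Longrightarrow> \<sigma> \<in> N"
  by (auto simp: divisor_closed_def)

lemma divisor_closed_sous_escalier:
  fixes J :: "(pp \<Rightarrow>\<^sub>0 'a::field) set"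
  assumes "monomial_ideal p J"
  shows "divisor_closed (sous_escalier p J)"
proof -
  interpret ideal J "poly_ring p" using assms by (simp add: monomial_ideal_def)
  have "Poly_Mapping.single (\<sigma> + \<tau>) 1 \<in> J"
    if "Poly_Mapping.single \<sigma> 1 \<in> J" "\<tau> \<in> pterms p" for \<sigma> \<tau>
    using I_r_closed[OF that(1), of "Poly_Mapping.single \<tau> 1"] that(2)
    by (simp add: poly_ring_def mult_single)
  then show ?thesis
    unfolding divisor_closed_def sous_escalier_def by (auto simp: add_in_pterms_iff)
qed

text \<open>\<open>J\<close> is generated by the terms outside \<open>N\<close>. No term of
  \<open>N\<close> slips in, because \<open>J\<close> lies in the ideal \<open>I\<close> of
  polynomials supported off \<open>N\<close>.\<close>

lemma monomial_ideal_with_sous_escalier: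
  assumes "N \<subseteq> pterms p" "divisor_closed N"
  obtains J :: "(pp \<Rightarrow>\<^sub>0 'a::field) set" where "monomial_ideal p J" "sous_escalier p J = N"
proof
  let ?R = "poly_ring p :: (pp \<Rightarrow>\<^sub>0 'a) ring"
  let ?S = "(\<lambda>\<tau>. Poly_Mapping.single \<tau> (1::'a)) ` (pterms p - N)"
  define J where "J = genideal ?R ?S"
  define I where "I = {f :: pp \<Rightarrow>\<^sub>0 'a. Poly_Mapping.keys f \<subseteq> pterms p - N}"
  interpret ring ?R by (rule ring_poly_ring)
  have S: "?S \<subseteq> carrier ?R" by (auto simp: poly_ring_def)
  show "monomial_ideal p J"
    unfolding monomial_ideal_def J_def using genideal_ideal[OF S] by blast
  \<comment> \<open>Divisor closure read contrapositively: the terms off \<open>N\<close> absorb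
    multiplication, which makes \<open>I\<close> an ideal.\<close>
  have mult: "\<sigma> + \<tau> \<in> pterms p - N" if "\<sigma> \<in> pterms p - N" "\<tau> \<in> pterms p" for \<sigma> \<tau>
    using that assms(2) by (auto simp: add_in_pterms_iff dest: divisor_closedD)
  have inv: "\<ominus>\<^bsub>?R\<^esub> f = - f" if "f \<in> carrier ?R" for f
    by (rule minus_equality) (use that in \<open>auto simp: poly_ring_def\<close>)
  have "ideal I ?R"
  proof (rule idealI)
    show "ring ?R" by (rule ring_poly_ring)
    show "subgroup I (add_monoid ?R)"
    proof (rule add.subgroupI)
      show "I \<subseteq> carrier ?R" by (auto simp: I_def poly_ring_def)
      show "I \<noteq> {}" by (auto simp: I_def intro!: exI[of _ 0])
      show "\<ominus>\<^bsub>?R\<^esub> f \<in> I" if "f \<in> I" for f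
      proof -
        have "f \<in> carrier ?R" using that by (auto simp: I_def poly_ring_def)
        then show ?thesis using that by (simp add: inv) (simp add: I_def)
      qed
      show "f \<oplus>\<^bsub>?R\<^esub> g \<in> I" if "f \<in> I" "g \<in> I" for f g
        using that Poly_Mapping.keys_add[of f g] by (auto simp: I_def poly_ring_def)
    qed
    show "g \<otimes>\<^bsub>?R\<^esub> f \<in> I" if "f \<in> I" "g \<in> carrier ?R" for f g
      using that keys_mult[of f g] mult
      by (fastforce simp: I_def poly_ring_def mult.commute[of g f])
    show "f \<otimes>\<^bsub>?R\<^esub> g \<in> I" if "f \<in> I" "g \<in> carrier ?R" for f g
      using that keys_mult[of f g] mult by (fastforce simp: I_def poly_ring_def)
  qed
  then have "J \<subseteq> I"
    unfolding J_def by (rule genideal_minimal) (auto simp: I_def)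
  moreover have "?S \<subseteq> J" unfolding J_def by (rule genideal_self[OF S])
  ultimately show "sous_escalier p J = N"
    using assms(1) by (auto simp: sous_escalier_def I_def)
qed

section \<open>Combinatorial description of the sets counted\<close>

definition lex_closed :: "nat \<Rightarrow> pp set \<Rightarrow> bool" where
  "lex_closed p N \<longleftrightarrow>
     (\<forall>\<tau>\<in>N. \<forall>\<sigma>\<in>pterms p. tdeg \<sigma> = tdeg \<tau> \<and> lex_less \<sigma> \<tau> \<longrightarrow> \<sigma> \<in> N)"

lemma lex_closedD:
  "lex_closed p N \<Longrightarrow> \<tau> \<in> N \<Longrightarrow> \<sigma> \<in> pterms p \<Longrightarrow> tdeg \<sigma> = tdeg \<tau> \<Longrightarrow> lex_less \<sigma> \<tau> \<Longrightarrow> \<sigma> \<in> N"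
  by (auto simp: lex_closed_def)

text \<open>Extra variables add no terms below those of \<open>N\<close>, by
  \<open>lex_less_pterms\<close>. This lets an ideal in \<open>q \<le> p\<close> variables be
  treated as one in \<open>p\<close> variables.\<close>

lemma lex_closed_mono:
  assumes "lex_closed q N" "N \<subseteq> pterms q"
  shows "lex_closed p N"
  unfolding lex_closed_def
proof safe
  fix \<sigma> \<tau> assume *: "\<tau> \<in> N" "\<sigma> \<in> pterms p" "tdeg \<sigma> = tdeg \<tau>" "lex_less \<sigma> \<tau>"
  then have "\<sigma> \<in> pterms q" using assms(2) lex_less_pterms by blast
  then show "\<sigma> \<in> N" using * assms(1) lex_closedD by blast
qed

text \<open>Members of \<open>M(p,n,k,d)\<close> in combinatorial form, with the multiplicity left
  out. The equivalence makes \<open>k\<close> the last full degree and, at degree 0, puts the term 1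
  into \<open>N\<close>.\<close>

definition stair :: "nat \<Rightarrow> nat \<Rightarrow> nat \<Rightarrow> pp set \<Rightarrow> bool" where
  "stair p n k N \<longleftrightarrow>
     N \<subseteq> pterms p \<and> divisor_closed N \<and> lex_closed p N \<and> (\<forall>\<tau>\<in>N. tdeg \<tau> \<le> n) \<and>
     (\<forall>i. deg_terms p i \<subseteq> N \<longleftrightarrow> i \<le> k)"

section \<open>Finiteness, multiplicity and full degrees\<close>

lemma finite_bounded_pterms: "finite {\<tau> \<in> pterms p. tdeg \<tau> \<le> n}"
proof -
  have "{\<tau> \<in> pterms p. tdeg \<tau> \<le> n} = (\<Union>t\<le>n. deg_terms p t)"
    by (auto simp: deg_terms_def)
  then show ?thesis by (simp add: finite_deg_terms)
qed

lemma finite_stairs: "finite {N. stair p n k N}"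
  by (rule finite_subset[of _ "Pow {\<tau> \<in> pterms p. tdeg \<tau> \<le> n}"])
     (auto simp: stair_def finite_bounded_pterms)

lemma stair_finite: "stair p n k N \<Longrightarrow> finite N"
  by (rule finite_subset[OF _ finite_bounded_pterms[of p n]]) (auto simp: stair_def)

text \<open>The socle degree is the maximal degree in \<open>N\<close>, which exists as
  \<open>N\<close> is finite and nonempty; the slices up to it partition \<open>N\<close>.\<close>

lemma degree_bound_and_card:
  fixes N :: "pp set"
  defines "h \<equiv> \<lambda>t. card {\<tau> \<in> N. tdeg \<tau> = t}"
  assumes "finite N" "N \<noteq> {}"
  shows "socle_degree h \<le> n \<longleftrightarrow> (\<forall>\<tau>\<in>N. tdeg \<tau> \<le> n)" and "multiplicity h = card N"
proof -
  have h: "h t \<noteq> 0 \<longleftrightarrow> (\<exists>\<tau>\<in>N. tdeg \<tau> = t)" for t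
    using \<open>finite N\<close> by (auto simp: h_def)
  have "socle_degree h = Max (tdeg ` N)"
    unfolding socle_degree_def
  proof (rule Greatest_equality)
    have "Max (tdeg ` N) \<in> tdeg ` N" using assms by (intro Max_in) auto
    then show "h (Max (tdeg ` N)) \<noteq> 0" unfolding h by auto
    show "t \<le> Max (tdeg ` N)" if "h t \<noteq> 0" for t
      using that \<open>finite N\<close> unfolding h by auto
  qed
  then have s: "socle_degree h \<le> n \<longleftrightarrow> (\<forall>\<tau>\<in>N. tdeg \<tau> \<le> n)" for n
    using assms by simp
  then show "socle_degree h \<le> n \<longleftrightarrow> (\<forall>\<tau>\<in>N. tdeg \<tau> \<le> n)" .
  have "N = (\<Union>t\<le>socle_degree h. {\<tau> \<in> N. tdeg \<tau> = t})" using s by blast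
  then have "card N = card (\<Union>t\<le>socle_degree h. {\<tau> \<in> N. tdeg \<tau> = t})" by simp
  also have "\<dots> = (\<Sum>t\<le>socle_degree h. card {\<tau> \<in> N. tdeg \<tau> = t})"
    using \<open>finite N\<close> by (intro card_UN_disjoint) auto
  finally show "multiplicity h = card N" by (simp add: multiplicity_def h_def)
qed

text \<open>The binomial coefficient counts all terms of degree \<open>i\<close>, and the slice of
  \<open>N\<close> is a subset of them.\<close>

lemma card_eq_binomial_iff:
  assumes "finite N" "N \<subseteq> pterms p" "p > 0"
  shows "card {\<tau> \<in> N. tdeg \<tau> = i} = (p - 1 + i) choose i \<longleftrightarrow> deg_terms p i \<subseteq> N"
    and "card {\<tau> \<in> N. tdeg \<tau> = i} < (p - 1 + i) choose i \<longleftrightarrow> \<not> deg_terms p i \<subseteq> N"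
proof -
  let ?N = "{\<tau> \<in> N. tdeg \<tau> = i}"
  have sub: "?N \<subseteq> deg_terms p i" using assms by (auto simp: deg_terms_def)
  have card: "card (deg_terms p i) = (p - 1 + i) choose i"
    using card_deg_terms[of "p - 1" i] assms by simp
  have eq: "deg_terms p i \<subseteq> N \<longleftrightarrow> ?N = deg_terms p i"
    using sub by (auto simp: deg_terms_def)
  have le: "card ?N \<le> card (deg_terms p i)" using sub finite_deg_terms card_mono by blast
  have "card ?N = card (deg_terms p i) \<longleftrightarrow> ?N = deg_terms p i"
    using card_subset_eq[OF finite_deg_terms sub] by auto
  then show "card ?N = (p - 1 + i) choose i \<longleftrightarrow> deg_terms p i \<subseteq> N"
      "card ?N < (p - 1 + i) choose i \<longleftrightarrow> \<not> deg_terms p i \<subseteq> N"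
    using le card eq by auto
qed

text \<open>Here ideals and the field drop out; everything afterwards concerns sets of terms
  only.\<close>

lemma lex_escaliers_eq:
  assumes "p > 0"
  shows "lex_escaliers TYPE('a::field) p n k d = {N. stair p n k N \<and> card N = d}"
proof -
  have main: "(multiplicity h = d \<and> socle_degree h \<le> n \<and>
        (\<forall>i\<le>k. h i = (p - 1 + i) choose i) \<and> (\<forall>i>k. h i < (p - 1 + i) choose i)) \<longleftrightarrow>
      (card N = d \<and> (\<forall>\<tau>\<in>N. tdeg \<tau> \<le> n) \<and> (\<forall>i. deg_terms p i \<subseteq> N \<longleftrightarrow> i \<le> k))"
    (is "?L \<longleftrightarrow> ?R")
    if N: "finite N" "N \<subseteq> pterms p" and h: "h = (\<lambda>t. card {\<tau> \<in> N. tdeg \<tau> = t})" for N h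
  proof -
    note full = card_eq_binomial_iff[OF N assms]
    \<comment> \<open>Either side makes degree 0 full, hence \<open>N\<close> is nonempty, as needed
      to rewrite the socle degree.\<close>
    have "N \<noteq> {}" if "deg_terms p 0 \<subseteq> N" using that by (auto simp: deg_terms_0)
    moreover have "h 0 = (p - 1 + 0) choose 0 \<longleftrightarrow> deg_terms p 0 \<subseteq> N"
      unfolding h by (rule full)
    ultimately have "N \<noteq> {}" if "?L \<or> ?R" using that by blast
    moreover have "?L \<longleftrightarrow> ?R" if "N \<noteq> {}"
    proof -
      have "(\<forall>i. deg_terms p i \<subseteq> N \<longleftrightarrow> i \<le> k) \<longleftrightarrow>
          (\<forall>i\<le>k. deg_terms p i \<subseteq> N) \<and> (\<forall>i>k. \<not> deg_terms p i \<subseteq> N)"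
        by (meson not_le)
      then show ?thesis
        unfolding h degree_bound_and_card[OF N(1) that] full by blast
    qed
    ultimately show ?thesis by blast
  qed
  show ?thesis
  proof (intro subset_antisym subsetI)
    fix N assume "N \<in> lex_escaliers TYPE('a) p n k d"
    then obtain q and J :: "(pp \<Rightarrow>\<^sub>0 'a) set" where N: "N = sous_escalier q J" and
      q: "q \<le> p" "lex_segment_ideal q J" "artinian q J" and
      h: "multiplicity (hilbert_function q J) = d" "socle_degree (hilbert_function q J) \<le> n"
        "\<forall>i\<le>k. hilbert_function q J i = (p - 1 + i) choose i"
        "\<forall>i>k. hilbert_function q J i < (p - 1 + i) choose i"
      unfolding lex_escaliers_def by blast
    have "N \<subseteq> pterms q" unfolding N sous_escalier_def by blast
    moreover have "lex_closed q N"
      using q(2) unfolding N lex_segment_ideal_def lex_closed_def by blast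
    moreover have "finite N" using q(3) by (simp add: N artinian_def)
    moreover have "divisor_closed N"
      using q(2) unfolding N lex_segment_ideal_def by (intro divisor_closed_sous_escalier) simp
    moreover have "hilbert_function q J = (\<lambda>t. card {\<tau> \<in> N. tdeg \<tau> = t})"
      by (auto simp: hilbert_function_def N)
    \<comment> \<open>\<open>J\<close> lives in \<open>q\<close> variables but fullness is measured
      against \<open>p\<close>, so the inclusion and the lex closure are first carried over to
      \<open>p\<close>.\<close>
    ultimately show "N \<in> {N. stair p n k N \<and> card N = d}"
      using main[of N "hilbert_function q J"] h pterms_mono[OF q(1)] lex_closed_mono[of q N p]
      by (auto simp: stair_def)
  next
    fix N assume "N \<in> {N. stair p n k N \<and> card N = d}"
    then have N: "stair p n k N" "card N = d" by auto
    have sub: "N \<subseteq> pterms p" "divisor_closed N" "lex_closed p N" using N by (auto simp: stair_def)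
    obtain J :: "(pp \<Rightarrow>\<^sub>0 'a) set" where J: "monomial_ideal p J" "sous_escalier p J = N"
      using monomial_ideal_with_sous_escalier[OF sub(1,2)] .
    have "hilbert_function p J = (\<lambda>t. card {\<tau> \<in> N. tdeg \<tau> = t})"
      by (auto simp: hilbert_function_def J)
    note main[OF stair_finite[OF N(1)] sub(1) this]
    moreover have "artinian p J" using stair_finite[OF N(1)] by (simp add: artinian_def J)
    moreover have "lex_segment_ideal p J"
      unfolding lex_segment_ideal_def J(2) using J(1) sub(3) by (auto simp: lex_closed_def)
    ultimately show "N \<in> lex_escaliers TYPE('a) p n k d"
      unfolding lex_escaliers_def mem_Collect_eq using N J(2)
      by (intro exI[of _ p] exI[of _ J]) (auto simp: stair_def)
  qed
qed

section \<open>Splitting off the highest variable\<close>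

text \<open>Inverse of the cut along the top variable; the union is disjoint once \<open>A\<close>
  is free of that variable.\<close>

definition var_join :: "nat \<Rightarrow> pp set \<Rightarrow> pp set \<Rightarrow> pp set" where
  "var_join p A B = A \<union> (+) (var p) ` B"

lemma var_add_in_var_join_iff:
  "A \<subseteq> pterms m \<Longrightarrow> var (Suc m) + \<sigma> \<in> var_join (Suc m) A B \<longleftrightarrow> \<sigma> \<in> B"
  using var_Suc_add_notin_pterms by (auto simp: var_join_def)

lemma pterms_in_var_join_iff:
  "\<tau> \<in> pterms m \<Longrightarrow> \<tau> \<in> var_join (Suc m) A B \<longleftrightarrow> \<tau> \<in> A"
  using var_Suc_add_notin_pterms by (auto simp: var_join_def)

lemma card_var_join:
  assumes "A \<subseteq> pterms m" "finite A" "finite B"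
  shows "card (var_join (Suc m) A B) = card A + card B"
proof -
  have "A \<inter> (+) (var (Suc m)) ` B = {}" using assms(1) var_Suc_add_notin_pterms by auto
  then show ?thesis
    unfolding var_join_def using assms by (simp add: card_Un_disjoint card_image)
qed

lemma stair_full: "stair p n k N \<Longrightarrow> \<tau> \<in> pterms p \<Longrightarrow> tdeg \<tau> \<le> k \<Longrightarrow> \<tau> \<in> N"
  by (auto simp: stair_def deg_terms_def)

text \<open>The delicate case of both closures compares a multiple of the top variable with a term
  free of it. The multiples in the join have degree at most \<open>i\<close>, and \<open>A\<close>
  contains all terms free of the top variable up to degree \<open>i\<close>, so nothing is
  missing.\<close>

lemma stair_var_join:
  assumes A: "stair m n i A" and B: "stair (Suc m) (i - 1) (k - 1) B"
    and "0 < k" "k \<le> i" "i \<le> n"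
  shows "stair (Suc m) n k (var_join (Suc m) A B)"
proof -
  let ?x = "var (Suc m)" and ?N = "var_join (Suc m) A B"
  have Asub: "A \<subseteq> pterms m" and Adiv: "divisor_closed A" and Alex: "lex_closed m A"
    and Adeg: "\<forall>\<tau>\<in>A. tdeg \<tau> \<le> n" using A by (auto simp: stair_def)
  have Bsub: "B \<subseteq> pterms (Suc m)" and Bdiv: "divisor_closed B" and Blex: "lex_closed (Suc m) B"
    and Bdeg: "\<And>\<tau>. \<tau> \<in> B \<Longrightarrow> tdeg \<tau> \<le> i - 1" using B by (auto simp: stair_def)
  note low = pterms_in_var_join_iff[of _ m A B] and high = var_add_in_var_join_iff[OF Asub, of _ B]
  have sub: "?N \<subseteq> pterms (Suc m)"
    using Asub Bsub pterms_mono[of m "Suc m"] by (auto simp: var_join_def var_add_in_pterms_iff)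
  have div: "divisor_closed ?N"
    unfolding divisor_closed_def
  proof safe
    fix \<sigma> \<rho> assume N: "\<sigma> + \<rho> \<in> ?N"
    then have p: "\<sigma> \<in> pterms (Suc m)" "\<rho> \<in> pterms (Suc m)"
      using sub by (auto simp: add_in_pterms_iff)
    from p(1) show "\<sigma> \<in> ?N"
    proof (cases rule: pterms_Suc_cases)
      case \<sigma>: 1
      from p(2) show ?thesis
      proof (cases rule: pterms_Suc_cases)
        case 1
        then have "\<sigma> + \<rho> \<in> A" using N \<sigma> by (simp add: low add_in_pterms_iff)
        then show ?thesis using divisor_closedD[OF Adiv] \<sigma> low by blast
      next
        case (2 \<rho>')
        then have "\<sigma> + \<rho>' \<in> B" using N high[of "\<sigma> + \<rho>'"] by (simp add: ac_simps)
        then have "tdeg \<sigma> \<le> i" using Bdeg[of "\<sigma> + \<rho>'"] by (simp add: tdeg_add)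
        then show ?thesis using stair_full[OF A \<sigma>] low \<sigma> by blast
      qed
    next
      case (2 \<sigma>')
      then have "\<sigma>' + \<rho> \<in> B" using N by (simp add: high add.assoc)
      then show ?thesis using divisor_closedD[OF Bdiv] 2 high by blast
    qed
  qed
  have lex: "lex_closed (Suc m) ?N"
    unfolding lex_closed_def
  proof safe
    fix \<sigma> \<tau> assume \<tau>: "\<tau> \<in> ?N" and \<sigma>: "\<sigma> \<in> pterms (Suc m)"
      and deg: "tdeg \<sigma> = tdeg \<tau>" and less: "lex_less \<sigma> \<tau>"
    from \<tau> sub have "\<tau> \<in> pterms (Suc m)" by blast
    then show "\<sigma> \<in> ?N"
    proof (cases rule: pterms_Suc_cases)
      case 1
      then have "\<sigma> \<in> pterms m" using lex_less_pterms less \<sigma> by blast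
      then show ?thesis using low 1 \<tau> lex_closedD[OF Alex] deg less by blast
    next
      case \<tau>': (2 \<tau>')
      then have \<tau>B: "\<tau>' \<in> B" using \<tau> high by blast
      from \<sigma> show ?thesis
      proof (cases rule: pterms_Suc_cases)
        case 1
        \<comment> \<open>The degree is at most \<open>Suc (i - 1)\<close>, which equals
          \<open>i\<close> because \<open>0 < k \<le> i\<close>.\<close>
        have "tdeg \<sigma> \<le> i"
          using Bdeg[OF \<tau>B] deg \<tau>' assms(3,4) by (simp add: tdeg_add tdeg_var)
        then show ?thesis using stair_full[OF A 1] low 1 by blast
      next
        case (2 \<sigma>')
        then have "tdeg \<sigma>' = tdeg \<tau>'" "lex_less \<sigma>' \<tau>'"
          using deg less \<tau>' by (simp_all add: tdeg_add lex_less_add_left_iff)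
        then have "\<sigma>' \<in> B" using lex_closedD[OF Blex \<tau>B] 2 by blast
        then show ?thesis using 2 high by blast
      qed
    qed
  qed
  have deg: "tdeg \<tau> \<le> n" if "\<tau> \<in> ?N" for \<tau>
    using that Adeg Bdeg assms(3-5) by (force simp: var_join_def tdeg_add tdeg_var)
  have full: "deg_terms (Suc m) t \<subseteq> ?N \<longleftrightarrow> t \<le> k" for t
  proof
    assume *: "deg_terms (Suc m) t \<subseteq> ?N"
    show "t \<le> k"
    proof (cases t)
      case (Suc s)
      \<comment> \<open>A full degree \<open>s + 1\<close> contains all multiples of the top
        variable, so \<open>B\<close> is full in degree \<open>s\<close>.\<close>
      have "deg_terms (Suc m) s \<subseteq> B"
      proof
        fix \<sigma> assume "\<sigma> \<in> deg_terms (Suc m) s"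
        then have "?x + \<sigma> \<in> ?N" using * Suc by (auto simp: deg_terms_Suc)
        then show "\<sigma> \<in> B" using high by blast
      qed
      then have "s \<le> k - 1" using B by (auto simp: stair_def)
      then show ?thesis using Suc assms(3) by simp
    qed simp
  next
    assume t: "t \<le> k"
    show "deg_terms (Suc m) t \<subseteq> ?N"
    proof
      fix \<tau> assume "\<tau> \<in> deg_terms (Suc m) t"
      then have \<tau>: "\<tau> \<in> pterms (Suc m)" "tdeg \<tau> = t" by (auto simp: deg_terms_def)
      \<comment> \<open>Terms free of the top variable lie in \<open>A\<close> since
        \<open>t \<le> k \<le> i\<close>; the others drop by one degree into the full range of
        \<open>B\<close>.\<close>
      from \<tau>(1) show "\<tau> \<in> ?N"
      proof (cases rule: pterms_Suc_cases)
        case 1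
        then show ?thesis using stair_full[OF A 1] low[OF 1] \<tau>(2) t assms(4) by simp
      next
        case (2 \<sigma>)
        then show ?thesis
          using stair_full[OF B 2(1)] high \<tau>(2) t by (simp add: tdeg_add tdeg_var)
      qed
    qed
  qed
  show ?thesis
    unfolding stair_def using sub div lex deg full by blast
qed

text \<open>The last full degree \<open>i\<close> of \<open>A\<close> exists because \<open>m > 0\<close> gives terms of every degree.\<close>

lemma stair_split:
  assumes N: "stair (Suc m) n k N" and "0 < k" "0 < m"
  obtains A B i where "N = var_join (Suc m) A B" "k \<le> i" "i \<le> n"
    "stair m n i A" "stair (Suc m) (i - 1) (k - 1) B"
proof -
  let ?x = "var (Suc m)"
  define A where "A = N \<inter> pterms m"
  define B where "B = {\<sigma>. ?x + \<sigma> \<in> N}"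
  have Nsub: "N \<subseteq> pterms (Suc m)" and Ndiv: "divisor_closed N" and Nlex: "lex_closed (Suc m) N"
    and Ndeg: "\<And>\<tau>. \<tau> \<in> N \<Longrightarrow> tdeg \<tau> \<le> n" using N by (auto simp: stair_def)
  have Bsub: "B \<subseteq> pterms (Suc m)" using Nsub by (auto simp: B_def var_add_in_pterms_iff)
  have mono: "pterms m \<subseteq> pterms (Suc m)" by (rule pterms_mono) simp
  have join: "N = var_join (Suc m) A B"
  proof (intro subset_antisym subsetI)
    fix \<tau> assume \<tau>: "\<tau> \<in> N"
    with Nsub have "\<tau> \<in> pterms (Suc m)" by blast
    then show "\<tau> \<in> var_join (Suc m) A B"
      by (cases rule: pterms_Suc_cases) (use \<tau> in \<open>auto simp: var_join_def A_def B_def\<close>)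
  qed (auto simp: var_join_def A_def B_def)
  have Adiv: "divisor_closed A"
    using Ndiv unfolding divisor_closed_def A_def by (auto simp: add_in_pterms_iff)
  have Alex: "lex_closed m A"
    using Nlex mono unfolding lex_closed_def A_def by blast
  have Bdiv: "divisor_closed B"
    using Ndiv unfolding divisor_closed_def B_def by (simp add: add.assoc[symmetric])
  have Blex: "lex_closed (Suc m) B"
    unfolding lex_closed_def
  proof safe
    fix \<sigma> \<tau>
    assume "\<tau> \<in> B" "\<sigma> \<in> pterms (Suc m)" "tdeg \<sigma> = tdeg \<tau>" "lex_less \<sigma> \<tau>"
    then show "\<sigma> \<in> B"
      using lex_closedD[OF Nlex, of "?x + \<tau>" "?x + \<sigma>"]
      by (simp add: B_def var_add_in_pterms_iff tdeg_add lex_less_add_left_iff)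
  qed
  \<comment> \<open>A term free of the top variable is lex-below any multiple of it. So one element
    of \<open>B\<close> in degree \<open>s\<close> fills degree \<open>s + 1\<close> of
    \<open>A\<close>.\<close>
  have low: "\<tau> \<in> A"
    if "\<sigma> \<in> B" "\<tau> \<in> pterms m" "tdeg \<tau> = Suc (tdeg \<sigma>)" for \<sigma> \<tau>
  proof -
    have "lex_less \<tau> (?x + \<sigma>)" using that Bsub by (intro lex_less_var_Suc_add) auto
    then show ?thesis
      using that mono lex_closedD[OF Nlex, of "?x + \<sigma>" \<tau>]
      by (auto simp: A_def B_def tdeg_add tdeg_var)
  qed
  \<comment> \<open>The full degrees of \<open>A\<close> form an initial segment, bounded by
    \<open>n\<close> and containing \<open>k\<close>; its maximum is the wanted
    \<open>i\<close>.\<close>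
  define F where "F = {t. deg_terms m t \<subseteq> A}"
  have F_Suc: "t \<in> F" if "Suc t \<in> F" for t
  proof -
    have "\<sigma> \<in> A" if "\<sigma> \<in> deg_terms m t" for \<sigma>
    proof -
      \<comment> \<open>Multiplying by \<open>var m\<close>, a variable since \<open>0 < m\<close>,
        leads to the full degree above; divisor closure leads back.\<close>
      have "\<sigma> + var m \<in> deg_terms m (Suc t)" using that \<open>0 < m\<close>
        by (simp add: deg_terms_def add_in_pterms_iff tdeg_add tdeg_var var_in_pterms_iff)
      then have "\<sigma> + var m \<in> A" using \<open>Suc t \<in> F\<close> by (auto simp: F_def)
      then show ?thesis by (rule divisor_closedD[OF Adiv])
    qed
    then show ?thesis by (auto simp: F_def)
  qed
  have F_down: "s \<in> F" if "s \<le> t" "t \<in> F" for s t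
    using that by (induction rule: inc_induct) (auto intro: F_Suc)
  have F_le: "t \<le> n" if "t \<in> F" for t
    using that deg_terms_nonempty[OF \<open>0 < m\<close>, of t] Ndeg
    by (force simp: F_def A_def deg_terms_def)
  define i where "i = Max F"
  have "finite F" by (rule finite_subset[of _ "{..n}"]) (auto intro: F_le)
  have "k \<in> F"
    using mono stair_full[OF N] by (auto simp: F_def A_def deg_terms_def)
  then have "i \<in> F" unfolding i_def using \<open>finite F\<close> by (intro Max_in) auto
  then have F_iff: "deg_terms m t \<subseteq> A \<longleftrightarrow> t \<le> i" for t
    using F_down[of t i] \<open>finite F\<close> by (auto simp: F_def i_def)
  have Bdeg: "tdeg \<sigma> \<le> i - 1" if "\<sigma> \<in> B" for \<sigma>
  proof -
    have "deg_terms m (Suc (tdeg \<sigma>)) \<subseteq> A" using low[OF that] by (auto simp: deg_terms_def)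
    then show ?thesis by (simp add: F_iff)
  qed
  have Bfull: "deg_terms (Suc m) t \<subseteq> B \<longleftrightarrow> t \<le> k - 1" for t
  proof
    assume *: "deg_terms (Suc m) t \<subseteq> B"
    \<comment> \<open>Any one element of \<open>B\<close> in degree \<open>t\<close> fills degree
      \<open>t + 1\<close> of \<open>A\<close>; with \<open>B\<close> full in degree
      \<open>t\<close>, \<open>N\<close> is full in degree \<open>t + 1\<close>.\<close>
    obtain \<sigma> where "\<sigma> \<in> deg_terms (Suc m) t" using deg_terms_nonempty[of "Suc m" t] by auto
    then have "deg_terms m (Suc t) \<subseteq> A"
      using low[of \<sigma>] * by (auto simp: deg_terms_def)
    then have "deg_terms (Suc m) (Suc t) \<subseteq> N"
      using * by (auto simp: deg_terms_Suc A_def B_def)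
    then have "Suc t \<le> k" using N by (auto simp: stair_def)
    then show "t \<le> k - 1" by simp
  next
    assume "t \<le> k - 1"
    then have "Suc t \<le> k" using \<open>0 < k\<close> by simp
    then have "deg_terms (Suc m) (Suc t) \<subseteq> N" using N unfolding stair_def by blast
    then show "deg_terms (Suc m) t \<subseteq> B" by (auto simp: deg_terms_Suc B_def)
  qed
  show ?thesis
  proof (rule that[OF join])
    show "k \<le> i" "i \<le> n" using \<open>k \<in> F\<close> \<open>finite F\<close> F_le[OF \<open>i \<in> F\<close>] by (auto simp: i_def)
    show "stair m n i A"
      unfolding stair_def using Adiv Alex Ndeg F_iff by (auto simp: A_def)
    show "stair (Suc m) (i - 1) (k - 1) B"
      unfolding stair_def using Bsub Bdiv Blex Bdeg Bfull by blast
  qed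
qed

section \<open>Uniqueness of the splitting and the count\<close>

lemma var_join_inject:
  assumes "var_join (Suc m) A B = var_join (Suc m) A' B'" "A \<subseteq> pterms m" "A' \<subseteq> pterms m"
  shows "A = A'" "B = B'"
proof -
  show "A = A'"
    using assms pterms_in_var_join_iff[of _ m A B] pterms_in_var_join_iff[of _ m A' B'] by blast
  show "B = B'"
    using assms(1) var_add_in_var_join_iff[OF assms(2), of _ B]
      var_add_in_var_join_iff[OF assms(3), of _ B'] by blast
qed

text \<open>Both are the last full degree of \<open>N\<close>. Hence the summation index
  \<open>i\<close> can be read off from \<open>A\<close>.\<close>

lemma stair_unique:
  assumes "stair p n k N" "stair p n k' N"
  shows "k = k'"
  using assms unfolding stair_def by (metis le_antisym order_refl)

text \<open>The term 1 lies in every stair. Applied to both \<open>A\<close> and \<open>B\<close>,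
  this gives the range of \<open>j\<close> from 1 to \<open>d - 1\<close>.\<close>

lemma stair_card_pos:
  assumes "stair p n k N"
  shows "0 < card N"
proof -
  have "0 \<in> N" using stair_full[OF assms zero_in_pterms] by (simp add: tdeg_def)
  then show ?thesis using stair_finite[OF assms] by (auto simp: card_gt_0_iff)
qed

theorem theorem4p3:
  fixes p n k d :: nat
  assumes "p > 1" and "n \<ge> 0" and "k > 0" and "d > 0"
  shows "num_lex_escaliers TYPE('a::field) p n k d =
    (\<Sum>j = 1..d - 1. \<Sum>i = k..n.
       num_lex_escaliers TYPE('a) (p - 1) n i (d - j) *
       num_lex_escaliers TYPE('a) p (i - 1) (k - 1) j)"
proof -
  obtain m where p: "p = Suc m" and "0 < m" using \<open>p > 1\<close> by (cases p) auto
  define M where "M = (\<lambda>p n k d. {N. stair p n k N \<and> card N = d})"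
  have num: "num_lex_escaliers TYPE('a) q n k d = card (M q n k d)" if "q > 0" for q n k d
    using that by (simp add: num_lex_escaliers_def lex_escaliers_eq M_def)
  have fin: "finite (M q n k d)" for q n k d
    by (rule finite_subset[OF _ finite_stairs[of q n k]]) (auto simp: M_def)
  \<comment> \<open>Pairs \<open>(A, B)\<close> are tagged with their indices, so the size of
    \<open>Sigma ?I Q\<close> is the double sum; injectivity then includes recovering the tags from
    \<open>N\<close>.\<close>
  define Q where "Q = (\<lambda>(j, i). M m n i (d - j) \<times> M p (i - 1) (k - 1) j)"
  let ?I = "{1..d - 1} \<times> {k..n}"
  let ?join = "\<lambda>((j :: nat, i :: nat), (A, B)). var_join p A B"
  have "bij_betw ?join (Sigma ?I Q) (M p n k d)"
    unfolding bij_betw_def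
  proof
    show "inj_on ?join (Sigma ?I Q)"
    proof (rule inj_onI)
      fix x y assume x: "x \<in> Sigma ?I Q" "y \<in> Sigma ?I Q" and join: "?join x = ?join y"
      obtain j i A B j' i' A' B' where xy: "x = ((j, i), (A, B))" "y = ((j', i'), (A', B'))"
        by (metis surj_pair)
      have Q: "(A, B) \<in> Q (j, i)" "(A', B') \<in> Q (j', i')"
        and eq: "var_join p A B = var_join p A' B'"
        using x join unfolding xy by auto
      from Q have st: "stair m n i A" "stair m n i' A'" and "card B = j" "card B' = j'"
        by (auto simp: Q_def M_def)
      moreover have "A = A'" "B = B'"
        using st var_join_inject[OF eq[unfolded p]] by (auto simp: stair_def)
      \<comment> \<open>\<open>j\<close> is the cardinality of \<open>B\<close>, and
        \<open>i\<close> is the last full degree of \<open>A\<close>.\<close>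
      ultimately show "x = y"
        using stair_unique xy by blast
    qed
    show "?join ` Sigma ?I Q = M p n k d"
    proof (intro subset_antisym subsetI)
      fix N assume "N \<in> ?join ` Sigma ?I Q"
      then obtain j i A B where N: "N = var_join (Suc m) A B" "j \<in> {1..d - 1}" "k \<le> i" "i \<le> n"
        and A: "stair m n i A" "card A = d - j"
        and B: "stair (Suc m) (i - 1) (k - 1) B" "card B = j"
        by (auto simp: Q_def M_def p)
      have "stair p n k N"
        using stair_var_join[OF A(1) B(1) \<open>k > 0\<close> N(3,4)] by (simp add: N(1) p)
      moreover have "A \<subseteq> pterms m" using A(1) by (simp add: stair_def)
      then have "card N = d"
        using card_var_join[of A m B] stair_finite[OF A(1)] stair_finite[OF B(1)] A(2) B(2) N(1,2)
        by auto
      ultimately show "N \<in> M p n k d" by (simp add: M_def)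
    next
      fix N assume "N \<in> M p n k d"
      then have N: "stair (Suc m) n k N" "card N = d" by (auto simp: M_def p)
      obtain A B i where AB: "N = var_join (Suc m) A B" "k \<le> i" "i \<le> n"
        and st: "stair m n i A" "stair (Suc m) (i - 1) (k - 1) B"
        using stair_split[OF N(1) \<open>k > 0\<close> \<open>0 < m\<close>] .
      have "A \<subseteq> pterms m" using st(1) by (simp add: stair_def)
      then have "d = card A + card B"
        using card_var_join stair_finite[OF st(1)] stair_finite[OF st(2)] N(2) AB(1) by blast
      then have "((card B, i), (A, B)) \<in> Sigma ?I Q"
        using st AB(2,3) stair_card_pos[OF st(1)] stair_card_pos[OF st(2)]
        by (auto simp: Q_def M_def p)
      then show "N \<in> ?join ` Sigma ?I Q" by (rule rev_image_eqI) (simp add: AB(1) p)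
    qed
  qed
  then have "card (M p n k d) = card (Sigma ?I Q)" by (simp add: bij_betw_same_card)
  also have "\<dots> = (\<Sum>ji\<in>?I. card (Q ji))"
    by (rule card_SigmaI) (auto simp: Q_def fin)
  also have "\<dots> = (\<Sum>j = 1..d - 1. \<Sum>i = k..n. card (M m n i (d - j)) * card (M p (i - 1) (k - 1) j))"
    by (simp add: sum.cartesian_product Q_def card_cartesian_product split_def)
  finally show ?thesis using \<open>0 < m\<close> by (simp add: num p)
qed

end
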